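(* Let $\varepsilon>0$ and let $P,Q$ be Borel probability measures on $\mathbb{R}^d$ that do not charge the boundary of any convex subset of $\mathbb{R}^d$, whose topological supports $\Omega:=\operatorname{spt}P$ and $\Omega':=\operatorname{spt}Q$ are compact, and such that $\Omega'$ is connected. Let $\eta\in(0,\varepsilon)$. Then the linearized gradient descent operator $\mathbb{L}:L^2_\oplus\to L^2_\oplus$, $$\mathbb{L}\begin{pmatrix}f\\ g\end{pmatrix}=\operatorname{proj}_\oplus\begin{pmatrix} f\,\big(1-\frac{\eta}{\varepsilon}Q(\mathcal{S}_{(\cdot)})\big)-\frac{\eta}{\varepsilon}\int_{\mathcal{S}_{(\cdot)}}g\,dQ\\ g\,\big(1-\frac{\eta}{\varepsilon}P(\mathcal{T}_{(\cdot)})\big)-\frac{\eta}{\varepsilon}\int_{\mathcal{T}_{(\cdot)}}f\,dP\end{pmatrix},$$ is a strict contraction, i.e., its operator norm satisfies $\|\mathbb{L}\|_{\mathrm{op}}<1$.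
   Context: $L^2_\oplus:=\{(f,g)\in L^2(P)\times L^2(Q):\int f\,dP=\int g\,dQ\}$ with the inner product inherited from $L^2(P)\times L^2(Q)$, i.e. $\langle (f,g),(u,v)\rangle_{L^2_\oplus}=\langle f,u\rangle_{L^2(P)}+\langle g,v\rangle_{L^2(Q)}$. The orthogonal projection $\operatorname{proj}_\oplus:L^2(P)\times L^2(Q)\to L^2_\oplus$ is $(f,g)\mapsto\big(f+\frac12(\int g\,dQ-\int f\,dP),\; g-\frac12(\int g\,dQ-\int f\,dP)\big)$. Write $(t)_+=\max\{t,0\}$. The potentials $(f_*,g_* )$ are the unique pair of continuous functions $f_*:\Omega\to\mathbb{R}$, $g_*:\Omega'\to\mathbb{R}$ with $\int f_*\,dP=\int g_*\,dQ$ solving $\varepsilon=\int(f_*(x)+g_*(y)-\frac12\|x-y\|^2)_+\,dP(x)$ for all $y\in\Omega'$ and $\varepsilon=\int(f_*(x)+g_*(y)-\frac12\|x-y\|^2)_+\,dQ(y)$ for all $x\in\Omega$. For $x\in\Omega$ and $y\in\Omega'$, $$\mathcal{S}_x:=\{y'\in\Omega': f_*(x)+g_*(y')-\tfrac12\|x-y'\|^2\ge0\},\qquad \mathcal{T}_y:=\{x'\in\Omega: f_*(x')+g_*(y)-\tfrac12\|x'-y\|^2\ge0\}.$$ In the formula for $\mathbb{L}$, the first component is a function of $x\in\Omega$ (with $\mathcal{S}_{(\cdot)}$ evaluated at $x$) and the second a function of $y\in\Omega'$. *)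

theory Defs
  imports "HOL-Probability.Probability"
begin

definition spt :: "'a::topological_space measure \<Rightarrow> 'a set" where
  "spt M = {x. \<forall>U. open U \<longrightarrow> x \<in> U \<longrightarrow> emeasure M U > 0}"

definition no_convex_boundary_mass :: "'a::real_normed_vector measure \<Rightarrow> bool" where
  "no_convex_boundary_mass M \<longleftrightarrow> (\<forall>C. convex C \<longrightarrow> emeasure M (frontier C) = 0)"

(* Elements of L^2 are represented by square-integrable functions, not by their classes modulo
   null sets; the norm below is therefore a seminorm on representatives, and compatibility of an
   operator with almost-everywhere equality is stated separately. *)
definition L2 :: "'a measure \<Rightarrow> ('a \<Rightarrow> real) set" where
  "L2 M = {f \<in> borel_measurable M. integrable M (\<lambda>x. (f x)\<^sup>2)}"

definition L2_oplus :: "'a measure \<Rightarrow> 'b measure \<Rightarrow> (('a \<Rightarrow> real) \<times> ('b \<Rightarrow> real)) set" where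
  "L2_oplus P Q = {(f, g). f \<in> L2 P \<and> g \<in> L2 Q \<and> (\<integral>x. f x \<partial>P) = (\<integral>y. g y \<partial>Q)}"

definition inner_oplus :: "'a measure \<Rightarrow> 'b measure \<Rightarrow>
    ('a \<Rightarrow> real) \<times> ('b \<Rightarrow> real) \<Rightarrow> ('a \<Rightarrow> real) \<times> ('b \<Rightarrow> real) \<Rightarrow> real" where
  "inner_oplus P Q h k =
     (\<integral>x. fst h x * fst k x \<partial>P) + (\<integral>y. snd h y * snd k y \<partial>Q)"

definition norm_oplus :: "'a measure \<Rightarrow> 'b measure \<Rightarrow>
    ('a \<Rightarrow> real) \<times> ('b \<Rightarrow> real) \<Rightarrow> real" where
  "norm_oplus P Q h = sqrt (inner_oplus P Q h h)"

definition proj_oplus :: "'a measure \<Rightarrow> 'b measure \<Rightarrow>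
    ('a \<Rightarrow> real) \<times> ('b \<Rightarrow> real) \<Rightarrow> ('a \<Rightarrow> real) \<times> ('b \<Rightarrow> real)" where
  "proj_oplus P Q = (\<lambda>(f, g).
     let c = ((\<integral>y. g y \<partial>Q) - (\<integral>x. f x \<partial>P)) / 2
     in ((\<lambda>x. f x + c), (\<lambda>y. g y - c)))"

definition ae_equal :: "'a measure \<Rightarrow> 'b measure \<Rightarrow>
    ('a \<Rightarrow> real) \<times> ('b \<Rightarrow> real) \<Rightarrow> ('a \<Rightarrow> real) \<times> ('b \<Rightarrow> real) \<Rightarrow> bool" where
  "ae_equal P Q h k \<longleftrightarrow>
     (AE x in P. fst h x = fst k x) \<and> (AE y in Q. snd h y = snd k y)"

(* T, given on representatives, induces a map of the quotient space into itself. *)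
definition operator_on_oplus :: "'a measure \<Rightarrow> 'b measure \<Rightarrow>
    (('a \<Rightarrow> real) \<times> ('b \<Rightarrow> real) \<Rightarrow> ('a \<Rightarrow> real) \<times> ('b \<Rightarrow> real)) \<Rightarrow> bool" where
  "operator_on_oplus P Q T \<longleftrightarrow>
     (\<forall>h\<in>L2_oplus P Q. T h \<in> L2_oplus P Q) \<and>
     (\<forall>h\<in>L2_oplus P Q. \<forall>k\<in>L2_oplus P Q. ae_equal P Q h k \<longrightarrow> ae_equal P Q (T h) (T k))"

(* Extended-real-valued, so that an unbounded operator has norm infinity. *)
definition op_norm_oplus :: "'a measure \<Rightarrow> 'b measure \<Rightarrow>
    (('a \<Rightarrow> real) \<times> ('b \<Rightarrow> real) \<Rightarrow> ('a \<Rightarrow> real) \<times> ('b \<Rightarrow> real)) \<Rightarrow> ereal" where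
  "op_norm_oplus P Q T =
     (SUP h\<in>{h \<in> L2_oplus P Q. norm_oplus P Q h \<le> 1}. ereal (norm_oplus P Q (T h)))"

(* The potentials are functions on the supports only. They are represented by total functions
   whose values off the supports are arbitrary (possibly non-measurable), so every integral
   involving them is taken over the support, which carries full mass. *)
definition potentials :: "real \<Rightarrow> 'a::euclidean_space measure \<Rightarrow> 'a measure \<Rightarrow>
    ('a \<Rightarrow> real) \<Rightarrow> ('a \<Rightarrow> real) \<Rightarrow> bool" where
  "potentials \<epsilon> P Q f g \<longleftrightarrow>
     continuous_on (spt P) f \<and> continuous_on (spt Q) g \<and>
     (LINT x:spt P|P. f x) = (LINT y:spt Q|Q. g y) \<and>
     (\<forall>y\<in>spt Q. \<epsilon> = (LINT x:spt P|P. max (f x + g y - (norm (x - y))\<^sup>2 / 2) 0)) \<and>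
     (\<forall>x\<in>spt P. \<epsilon> = (LINT y:spt Q|Q. max (f x + g y - (norm (x - y))\<^sup>2 / 2) 0))"

definition section_S :: "'a::euclidean_space measure \<Rightarrow> ('a \<Rightarrow> real) \<Rightarrow> ('a \<Rightarrow> real) \<Rightarrow>
    'a \<Rightarrow> 'a set" where
  "section_S Q f g x = {y \<in> spt Q. f x + g y - (norm (x - y))\<^sup>2 / 2 \<ge> 0}"

definition section_T :: "'a::euclidean_space measure \<Rightarrow> ('a \<Rightarrow> real) \<Rightarrow> ('a \<Rightarrow> real) \<Rightarrow>
    'a \<Rightarrow> 'a set" where
  "section_T P f g y = {x \<in> spt P. f x + g y - (norm (x - y))\<^sup>2 / 2 \<ge> 0}"

(* The components are functions on the supports; off the supports (null sets) they are set to 0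
   because the sections are meaningless there. *)
definition lin_gd :: "real \<Rightarrow> real \<Rightarrow> 'a::euclidean_space measure \<Rightarrow> 'a measure \<Rightarrow>
    ('a \<Rightarrow> real) \<Rightarrow> ('a \<Rightarrow> real) \<Rightarrow>
    ('a \<Rightarrow> real) \<times> ('a \<Rightarrow> real) \<Rightarrow> ('a \<Rightarrow> real) \<times> ('a \<Rightarrow> real)" where
  "lin_gd \<eta> \<epsilon> P Q fs gs = (\<lambda>(f, g). proj_oplus P Q
     ((\<lambda>x. if x \<in> spt P then
             f x * (1 - \<eta> / \<epsilon> * measure Q (section_S Q fs gs x))
               - \<eta> / \<epsilon> * (LINT y:section_S Q fs gs x|Q. g y)
           else 0),
      (\<lambda>y. if y \<in> spt Q then
             g y * (1 - \<eta> / \<epsilon> * measure P (section_T P fs gs y))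
               - \<eta> / \<epsilon> * (LINT x:section_T P fs gs y|P. f x)
           else 0)))"

end

theory Submission
  imports Defs
begin

text \<open>
  Write \<open>E\<close> for the set of pairs \<open>(x, y)\<close> of support points with
  \<open>f\<^sub>*(x) + g\<^sub>*(y) - |x - y|\<^sup>2 / 2 \<ge> 0\<close>, so that \<open>\<S>\<^sub>x\<close> and \<open>\<T>\<^sub>y\<close> are the sections of \<open>E\<close>, and
  consider the quadratic form \<open>D(f, g) = \<integral>\<integral>\<^bsub>E\<^esub> (f(x) + g(y))\<^sup>2 dP dQ\<close>. Half its gradient is the pair
  \<open>A(f, g)\<close> with components \<open>\<integral>\<^bsub>\<S>\<^sub>x\<^esub> (f(x) + g) dQ\<close> and \<open>\<integral>\<^bsub>\<T>\<^sub>y\<^esub> (f + g(y)) dP\<close>, and the linearized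
  operator is the projection of \<open>h - c A h\<close> with \<open>c = \<eta> / \<epsilon> < 1\<close>.

  Since \<open>\<langle>A h, h\<rangle> = D(h)\<close> and, by Jensen's inequality in each of the two variables,
  \<open>\<parallel>A h\<parallel>\<^sup>2 \<le> 2 D(h)\<close>, one step satisfies
  \<open>\<parallel>h - c A h\<parallel>\<^sup>2 \<le> \<parallel>h\<parallel>\<^sup>2 - 2 c (1 - c) D(h)\<close> (lemma \<open>gradient_step_norm_le\<close>), and the projection does not
  increase norms. Strict contraction therefore follows from a spectral gap for \<open>D\<close>,
  i.e. from the Poincare-type inequality \<open>\<parallel>h\<parallel>\<^sup>2 \<le> C D(h)\<close> on pairs with \<open>\<integral>f dP = \<integral>g dQ\<close>
  (theorem \<open>poincare_inequality\<close>).

  The inequality is proved by hand, without compact operators. The equations for the potentials give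
  every \<open>y\<close> in the support of \<open>Q\<close> a partner \<open>x\<close> at which the slack is strictly positive, so by
  continuity \<open>E\<close> contains a product \<open>U \<times> V\<close> of neighbourhoods of positive mass. On such a rectangle
  \<open>D\<close> controls the deviation of \<open>g\<close> on \<open>V\<close> from a constant, namely minus the mean of \<open>f\<close> on \<open>U\<close>
  (\<open>rectangle_estimate\<close>). Two overlapping neighbourhoods have nearby constants
  (\<open>deviation_transfer\<close>); as the support of \<open>Q\<close> is connected and compact, a single constant \<open>a\<close>
  works everywhere: \<open>\<integral>(g - a)\<^sup>2 dQ \<le> C\<^sub>1 D\<close>. The masses \<open>Q(\<S>\<^sub>x)\<close> are bounded below, because \<open>\<epsilon>\<close> is at
  most the maximal slack times \<open>Q(\<S>\<^sub>x)\<close>; hence \<open>f\<close> is close to \<open>-a\<close> as well (\<open>fibre_estimate\<close>).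
  The normalization \<open>\<integral>f dP = \<integral>g dQ\<close> finally compares \<open>a\<close> with \<open>-a\<close> and makes \<open>a\<close> itself small.
\<close>

section \<open>Square-integrable functions\<close>

lemma L2_iff: "f \<in> L2 M \<longleftrightarrow> f \<in> borel_measurable M \<and> integrable M (\<lambda>x. (f x)\<^sup>2)"
  by (simp add: L2_def)

lemma L2_measurable [measurable_dest]: "f \<in> L2 M \<Longrightarrow> f \<in> borel_measurable M"
  by (simp add: L2_def)

lemma L2_squareD: "f \<in> L2 M \<Longrightarrow> integrable M (\<lambda>x. (f x)\<^sup>2)"
  by (simp add: L2_def)

lemma L2_I_bound:
  assumes [measurable]: "f \<in> borel_measurable M"
    and "integrable M w" and "AE x in M. (f x)\<^sup>2 \<le> w x"
  shows "f \<in> L2 M"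
  unfolding L2_iff
  by (intro conjI assms(1) Bochner_Integration.integrable_bound[OF assms(2)])
    (use assms(3) in \<open>auto elim: eventually_mono\<close>)

lemma L2_mult_integrable:
  assumes f: "f \<in> L2 M" and g: "g \<in> L2 M"
  shows "integrable M (\<lambda>x. f x * g x)"
proof (rule Bochner_Integration.integrable_bound)
  show "integrable M (\<lambda>x. (f x)\<^sup>2 + (g x)\<^sup>2)"
    using L2_squareD[OF f] L2_squareD[OF g] by simp
  show "(\<lambda>x. f x * g x) \<in> borel_measurable M"
    using f g by measurable
  have "\<bar>a * b\<bar> \<le> \<bar>a\<^sup>2 + b\<^sup>2\<bar>" for a b :: real
    using sum_squares_bound[of "\<bar>a\<bar>" "\<bar>b\<bar>"] mult_nonneg_nonneg[of "\<bar>a\<bar>" "\<bar>b\<bar>"]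
    unfolding abs_mult power2_abs by linarith
  then show "AE x in M. norm (f x * g x) \<le> norm ((f x)\<^sup>2 + (g x)\<^sup>2)"
    by simp
qed

lemma L2_add:
  assumes f: "f \<in> L2 M" and g: "g \<in> L2 M"
  shows "(\<lambda>x. f x + g x) \<in> L2 M"
  unfolding L2_iff
proof
  show "(\<lambda>x. f x + g x) \<in> borel_measurable M"
    using f g by measurable
  show "integrable M (\<lambda>x. (f x + g x)\<^sup>2)"
    using L2_mult_integrable[OF f g] L2_squareD[OF f] L2_squareD[OF g]
    by (simp add: power2_sum mult.assoc)
qed

lemma L2_cmult:
  assumes f: "f \<in> L2 M"
  shows "(\<lambda>x. c * f x) \<in> L2 M"
  unfolding L2_iff
proof
  show "(\<lambda>x. c * f x) \<in> borel_measurable M"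
    using f by measurable
  show "integrable M (\<lambda>x. (c * f x)\<^sup>2)"
    using L2_squareD[OF f] by (simp add: power_mult_distrib)
qed

lemma L2_diff: "f \<in> L2 M \<Longrightarrow> g \<in> L2 M \<Longrightarrow> (\<lambda>x. f x - g x) \<in> L2 M"
  using L2_add[of f M "\<lambda>x. - 1 * g x"] L2_cmult[of g M "-1"] by simp

lemma L2_indicator_mult:
  assumes [measurable]: "A \<in> sets M" and f: "f \<in> L2 M"
  shows "(\<lambda>x. indicator A x * f x) \<in> L2 M"
proof (rule L2_I_bound[OF _ L2_squareD[OF f]])
  show "(\<lambda>x. indicator A x * f x) \<in> borel_measurable M"
    using f by measurable
qed (simp add: indicator_def)

lemma L2_cong_AE:
  assumes "f \<in> L2 M" "g \<in> borel_measurable M" "AE x in M. f x = g x"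
  shows "g \<in> L2 M"
  by (rule L2_I_bound[OF assms(2) L2_squareD[OF assms(1)]])
    (use assms(3) in \<open>auto elim: eventually_mono\<close>)

lemma (in finite_measure) L2_const: "(\<lambda>x. c) \<in> L2 M"
  by (simp add: L2_iff)

lemma (in finite_measure) L2_integrable: "f \<in> L2 M \<Longrightarrow> integrable M f"
  by (auto simp: L2_iff intro: square_integrable_imp_integrable)

lemma (in prob_space) integral_square_le:
  assumes f: "f \<in> L2 M"
  shows "(\<integral>x. f x \<partial>M)\<^sup>2 \<le> (\<integral>x. (f x)\<^sup>2 \<partial>M)"
  using variance_eq[OF L2_integrable[OF f] L2_squareD[OF f]] variance_positive[of f] by simp

section \<open>Square-integrable functions on a product of probability spaces\<close>

text \<open>Jensen's inequality in each section makes integrating out a variable a contraction of $L^2$.\<close>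

lemma (in pair_prob_space) L2_marginal_fst:
  assumes F: "F \<in> L2 (M1 \<Otimes>\<^sub>M M2)"
  shows "(\<lambda>x. \<integral>y. F (x, y) \<partial>M2) \<in> L2 M1" (is ?mem)
    and "(\<integral>x. (\<integral>y. F (x, y) \<partial>M2)\<^sup>2 \<partial>M1) \<le> (\<integral>z. (F z)\<^sup>2 \<partial>(M1 \<Otimes>\<^sub>M M2))" (is ?le)
proof -
  have [measurable]: "F \<in> borel_measurable (M1 \<Otimes>\<^sub>M M2)"
    using F by (rule L2_measurable)
  note sq = L2_squareD[OF F]
  have le: "AE x in M1. (\<integral>y. F (x, y) \<partial>M2)\<^sup>2 \<le> (\<integral>y. (F (x, y))\<^sup>2 \<partial>M2)"
    using AE_integrable_fst'[OF sq] AE_space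
  proof eventually_elim
    case (elim x)
    then have "(\<lambda>y. F (x, y)) \<in> L2 M2"
      unfolding L2_iff by auto
    then show ?case
      by (rule M2.integral_square_le)
  qed
  show mem: ?mem
    by (rule L2_I_bound[OF _ integrable_fst'[OF sq] le]) measurable
  show ?le
    using integral_mono_AE[OF L2_squareD[OF mem] integrable_fst'[OF sq] le]
    by (simp add: integral_fst'[OF sq])
qed

lemma (in pair_prob_space) L2_swap:
  assumes F: "F \<in> L2 (M1 \<Otimes>\<^sub>M M2)"
  shows "(\<lambda>(y, x). F (x, y)) \<in> L2 (M2 \<Otimes>\<^sub>M M1)"
  unfolding L2_iff
proof
  have [measurable]: "F \<in> borel_measurable (M1 \<Otimes>\<^sub>M M2)"
    using F by (rule L2_measurable)
  show "(\<lambda>(y, x). F (x, y)) \<in> borel_measurable (M2 \<Otimes>\<^sub>M M1)"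
    by measurable
  show "integrable (M2 \<Otimes>\<^sub>M M1) (\<lambda>z. (case z of (y, x) \<Rightarrow> F (x, y))\<^sup>2)"
    using integrable_product_swap[OF L2_squareD[OF F]] by (simp add: case_prod_unfold)
qed

lemma (in pair_prob_space) L2_marginal_snd:
  assumes F: "F \<in> L2 (M1 \<Otimes>\<^sub>M M2)"
  shows "(\<lambda>y. \<integral>x. F (x, y) \<partial>M1) \<in> L2 M2"
    and "(\<integral>y. (\<integral>x. F (x, y) \<partial>M1)\<^sup>2 \<partial>M2) \<le> (\<integral>z. (F z)\<^sup>2 \<partial>(M1 \<Otimes>\<^sub>M M2))"
proof -
  interpret sw: pair_prob_space M2 M1 ..
  have [measurable]: "F \<in> borel_measurable (M1 \<Otimes>\<^sub>M M2)"
    using F by (rule L2_measurable)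
  show "(\<lambda>y. \<integral>x. F (x, y) \<partial>M1) \<in> L2 M2"
    using sw.L2_marginal_fst(1)[OF L2_swap[OF F]] by simp
  show "(\<integral>y. (\<integral>x. F (x, y) \<partial>M1)\<^sup>2 \<partial>M2) \<le> (\<integral>z. (F z)\<^sup>2 \<partial>(M1 \<Otimes>\<^sub>M M2))"
    using sw.L2_marginal_fst(2)[OF L2_swap[OF F]] integral_product_swap[of "\<lambda>z. (F z)\<^sup>2"]
    by (simp add: case_prod_unfold)
qed

lemma (in pair_prob_space) L2_comp_fst:
  assumes f: "f \<in> L2 M1"
  shows "(\<lambda>z. f (fst z)) \<in> L2 (M1 \<Otimes>\<^sub>M M2)"
    and "(\<integral>z. (f (fst z))\<^sup>2 \<partial>(M1 \<Otimes>\<^sub>M M2)) = (\<integral>x. (f x)\<^sup>2 \<partial>M1)"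
proof -
  have [measurable]: "f \<in> borel_measurable M1"
    using f by (rule L2_measurable)
  have d: "distr (M1 \<Otimes>\<^sub>M M2) M1 fst = M1"
    by (rule M2.distr_pair_fst)
  show "(\<lambda>z. f (fst z)) \<in> L2 (M1 \<Otimes>\<^sub>M M2)"
    unfolding L2_iff
    using integrable_distr_eq[of fst "M1 \<Otimes>\<^sub>M M2" M1 "\<lambda>x. (f x)\<^sup>2"] L2_squareD[OF f] d by simp
  show "(\<integral>z. (f (fst z))\<^sup>2 \<partial>(M1 \<Otimes>\<^sub>M M2)) = (\<integral>x. (f x)\<^sup>2 \<partial>M1)"
    using integral_distr[of fst "M1 \<Otimes>\<^sub>M M2" M1 "\<lambda>x. (f x)\<^sup>2"] d by simp
qed

lemma (in pair_prob_space) L2_comp_snd: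
  assumes g: "g \<in> L2 M2"
  shows "(\<lambda>z. g (snd z)) \<in> L2 (M1 \<Otimes>\<^sub>M M2)"
    and "(\<integral>z. (g (snd z))\<^sup>2 \<partial>(M1 \<Otimes>\<^sub>M M2)) = (\<integral>y. (g y)\<^sup>2 \<partial>M2)"
proof -
  interpret sw: pair_prob_space M2 M1 ..
  have [measurable]: "g \<in> borel_measurable M2"
    using g by (rule L2_measurable)
  show "(\<lambda>z. g (snd z)) \<in> L2 (M1 \<Otimes>\<^sub>M M2)"
    using sw.L2_swap[OF sw.L2_comp_fst(1)[OF g]] by (simp add: case_prod_unfold)
  show "(\<integral>z. (g (snd z))\<^sup>2 \<partial>(M1 \<Otimes>\<^sub>M M2)) = (\<integral>y. (g y)\<^sup>2 \<partial>M2)"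
    using integral_product_swap[of "\<lambda>z. (g (snd z))\<^sup>2"] sw.L2_comp_fst(2)[OF g]
    by (simp add: case_prod_unfold)
qed

section \<open>The quadratic form of a relation between two probability spaces\<close>

lemma square_add_le: "(a + b)\<^sup>2 \<le> 2 * a\<^sup>2 + 2 * b\<^sup>2" for a b :: real
  using sum_squares_bound[of a b] by (simp add: power2_sum)

text \<open>
  The relation \<open>E\<close> stands for the contact set of the potentials.
\<close>

locale coupled_prob_spaces = pair_prob_space P Q
  for P :: "'a measure" and Q :: "'b measure" +
  fixes E :: "('a \<times> 'b) set"
  assumes E_sets [measurable]: "E \<in> sets (P \<Otimes>\<^sub>M Q)"
begin

definition coupled_sum :: "('a \<Rightarrow> real) \<Rightarrow> ('b \<Rightarrow> real) \<Rightarrow> 'a \<times> 'b \<Rightarrow> real" where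
  "coupled_sum f g z = indicator E z * (f (fst z) + g (snd z))"

definition energy :: "('a \<Rightarrow> real) \<Rightarrow> ('b \<Rightarrow> real) \<Rightarrow> real" where
  "energy f g = (\<integral>z. (coupled_sum f g z)\<^sup>2 \<partial>(P \<Otimes>\<^sub>M Q))"

text \<open>
  \<open>grad_fst f g\<close> and \<open>grad_snd f g\<close> are the two components of half the \<open>L\<^sup>2\<close>-gradient of the energy
  at \<open>(f, g)\<close>.
\<close>

definition grad_fst :: "('a \<Rightarrow> real) \<Rightarrow> ('b \<Rightarrow> real) \<Rightarrow> 'a \<Rightarrow> real" where
  "grad_fst f g x = (\<integral>y. coupled_sum f g (x, y) \<partial>Q)"

definition grad_snd :: "('a \<Rightarrow> real) \<Rightarrow> ('b \<Rightarrow> real) \<Rightarrow> 'b \<Rightarrow> real" where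
  "grad_snd f g y = (\<integral>x. coupled_sum f g (x, y) \<partial>P)"

lemma coupled_sum_L2:
  assumes "f \<in> L2 P" "g \<in> L2 Q"
  shows "coupled_sum f g \<in> L2 (P \<Otimes>\<^sub>M Q)"
  using L2_indicator_mult[OF E_sets L2_add[OF L2_comp_fst(1)[OF assms(1)] L2_comp_snd(1)[OF assms(2)]]]
  by (simp add: coupled_sum_def[abs_def])

lemma grad_L2:
  assumes "f \<in> L2 P" "g \<in> L2 Q"
  shows "grad_fst f g \<in> L2 P" "grad_snd f g \<in> L2 Q"
  using L2_marginal_fst(1)[OF coupled_sum_L2[OF assms]] L2_marginal_snd(1)[OF coupled_sum_L2[OF assms]]
  by (simp_all add: grad_fst_def[abs_def] grad_snd_def[abs_def])

lemma grad_norm_le: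
  assumes "f \<in> L2 P" "g \<in> L2 Q"
  shows "(\<integral>x. (grad_fst f g x)\<^sup>2 \<partial>P) \<le> energy f g" "(\<integral>y. (grad_snd f g y)\<^sup>2 \<partial>Q) \<le> energy f g"
  using L2_marginal_fst(2)[OF coupled_sum_L2[OF assms]] L2_marginal_snd(2)[OF coupled_sum_L2[OF assms]]
  by (simp_all add: grad_fst_def grad_snd_def energy_def)

lemma grad_pairing:
  assumes f: "f \<in> L2 P" and g: "g \<in> L2 Q"
  shows "(\<integral>x. f x * grad_fst f g x \<partial>P) + (\<integral>y. g y * grad_snd f g y \<partial>Q) = energy f g"
proof -
  let ?F = "coupled_sum f g"
  note F = coupled_sum_L2[OF f g]
  have 1: "integrable (P \<Otimes>\<^sub>M Q) (\<lambda>z. f (fst z) * ?F z)"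
    by (rule L2_mult_integrable[OF L2_comp_fst(1)[OF f] F])
  have 2: "integrable (P \<Otimes>\<^sub>M Q) (\<lambda>z. g (snd z) * ?F z)"
    by (rule L2_mult_integrable[OF L2_comp_snd(1)[OF g] F])
  have "(\<integral>x. f x * grad_fst f g x \<partial>P) = (\<integral>z. f (fst z) * ?F z \<partial>(P \<Otimes>\<^sub>M Q))"
    using integral_fst'[OF 1] by (simp add: grad_fst_def)
  moreover have "(\<integral>y. g y * grad_snd f g y \<partial>Q) = (\<integral>z. g (snd z) * ?F z \<partial>(P \<Otimes>\<^sub>M Q))"
    using integral_snd[of "\<lambda>x y. g y * ?F (x, y)"] 2 by (simp add: grad_snd_def case_prod_unfold)
  moreover have "energy f g = (\<integral>z. f (fst z) * ?F z + g (snd z) * ?F z \<partial>(P \<Otimes>\<^sub>M Q))"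
    unfolding energy_def
    by (intro Bochner_Integration.integral_cong refl)
      (simp add: coupled_sum_def indicator_def power2_eq_square algebra_simps)
  ultimately show ?thesis
    using 1 2 by simp
qed

text \<open>
  The expansion of the square produces \<open>- 2 c D\<close> from \<open>grad_pairing\<close> and at most \<open>2 c\<^sup>2 D\<close> from
  applying \<open>grad_norm_le\<close> to each component.
\<close>

lemma gradient_step_norm_le:
  assumes f: "f \<in> L2 P" and g: "g \<in> L2 Q"
  shows "(\<integral>x. (f x - c * grad_fst f g x)\<^sup>2 \<partial>P) + (\<integral>y. (g y - c * grad_snd f g y)\<^sup>2 \<partial>Q)
     \<le> (\<integral>x. (f x)\<^sup>2 \<partial>P) + (\<integral>y. (g y)\<^sup>2 \<partial>Q) - 2 * c * (1 - c) * energy f g"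
proof -
  have expand: "(\<integral>x. (h x - c * k x)\<^sup>2 \<partial>M)
      = (\<integral>x. (h x)\<^sup>2 \<partial>M) - 2 * c * (\<integral>x. h x * k x \<partial>M) + c\<^sup>2 * (\<integral>x. (k x)\<^sup>2 \<partial>M)"
    if "h \<in> L2 M" "k \<in> L2 M" for h k :: "'c \<Rightarrow> real" and M
  proof -
    have "(\<lambda>x. (h x - c * k x)\<^sup>2) = (\<lambda>x. (h x)\<^sup>2 - 2 * c * (h x * k x) + c\<^sup>2 * (k x)\<^sup>2)"
      by (auto simp: power2_eq_square algebra_simps)
    then show ?thesis
      using L2_squareD[OF that(1)] L2_squareD[OF that(2)] L2_mult_integrable[OF that] by simp
  qed
  have "c\<^sup>2 * ((\<integral>x. (grad_fst f g x)\<^sup>2 \<partial>P) + (\<integral>y. (grad_snd f g y)\<^sup>2 \<partial>Q)) \<le> c\<^sup>2 * (2 * energy f g)"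
    using grad_norm_le[OF f g] by (intro mult_left_mono) auto
  then show ?thesis
    unfolding expand[OF f grad_L2(1)[OF f g]] expand[OF g grad_L2(2)[OF f g]]
      grad_pairing[OF f g, symmetric]
    by (simp add: power2_eq_square algebra_simps)
qed

text \<open>
  For fixed \<open>y\<close> in \<open>V\<close>, integrating \<open>f + g(y)\<close> over \<open>U\<close> gives \<open>P(U) (g(y) - b)\<close>. Jensen's inequality
  in the full space \<open>P\<close> rather than in the restriction to \<open>U\<close> costs one extra factor \<open>P(U)\<close>,
  whence the square in the denominator.
\<close>

lemma rectangle_estimate:
  assumes f: "f \<in> L2 P" and g: "g \<in> L2 Q"
    and U [measurable]: "U \<in> sets P" and V [measurable]: "V \<in> sets Q"
    and pos: "measure P U > 0" and sub: "U \<times> V \<subseteq> E"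
  defines "b \<equiv> - (\<integral>x. indicator U x * f x \<partial>P) / measure P U"
  shows "(\<integral>y. indicator V y * (g y - b)\<^sup>2 \<partial>Q) \<le> energy f g / (measure P U)\<^sup>2"
proof -
  let ?p = "measure P U"
  define G where "G = (\<lambda>z. indicator (U \<times> V) z * coupled_sum f g z)"
  have UV: "U \<times> V \<in> sets (P \<Otimes>\<^sub>M Q)"
    by simp
  have G: "G \<in> L2 (P \<Otimes>\<^sub>M Q)"
    unfolding G_def by (rule L2_indicator_mult[OF UV coupled_sum_L2[OF f g]])
  have intf: "integrable P (\<lambda>x. indicator U x * f x)"
    using M1.L2_integrable[OF L2_indicator_mult[OF U f]] .
  have sec: "(\<integral>x. G (x, y) \<partial>P) = indicator V y * (?p * (g y - b))" for y
  proof -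
    have "(\<integral>x. G (x, y) \<partial>P) = (\<integral>x. indicator V y * (indicator U x * f x + indicator U x * g y) \<partial>P)"
      using sub by (intro Bochner_Integration.integral_cong refl)
        (auto simp: G_def coupled_sum_def indicator_def)
    also have "\<dots> = indicator V y * ((\<integral>x. indicator U x * f x \<partial>P) + ?p * g y)"
      using intf by (simp add: M1.emeasure_eq_measure)
    also have "\<dots> = indicator V y * (?p * (g y - b))"
      using pos by (simp add: b_def field_simps)
    finally show ?thesis .
  qed
  have "(\<integral>x. G (x, y) \<partial>P)\<^sup>2 = ?p\<^sup>2 * (indicator V y * (g y - b)\<^sup>2)" for y
    by (simp add: sec indicator_def power_mult_distrib)
  then have "?p\<^sup>2 * (\<integral>y. indicator V y * (g y - b)\<^sup>2 \<partial>Q) = (\<integral>y. (\<integral>x. G (x, y) \<partial>P)\<^sup>2 \<partial>Q)"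
    by simp
  also have "\<dots> \<le> (\<integral>z. (G z)\<^sup>2 \<partial>(P \<Otimes>\<^sub>M Q))"
    by (rule L2_marginal_snd(2)[OF G])
  also have "\<dots> \<le> energy f g"
    unfolding energy_def
    by (intro integral_mono L2_squareD[OF G] L2_squareD[OF coupled_sum_L2[OF f g]])
      (simp add: G_def indicator_def)
  finally show ?thesis
    using pos by (simp add: field_simps)
qed

text \<open>
  The bound on \<open>g - a\<close> passes to \<open>f + a\<close> through \<open>f(x) + a = (f(x) + g(y)) - (g(y) - a)\<close> on \<open>E\<close>; the
  weight that the fibre over \<open>x\<close> puts on \<open>(f(x) + a)\<^sup>2\<close> is at least \<open>\<kappa>\<close>.
\<close>

lemma fibre_estimate:
  assumes f: "f \<in> L2 P" and g: "g \<in> L2 Q"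
    and \<kappa>: "AE x in P. \<kappa> \<le> measure Q (Pair x -` E)"
  shows "\<kappa> * (\<integral>x. (f x + a)\<^sup>2 \<partial>P) \<le> 2 * energy f g + 2 * (\<integral>y. (g y - a)\<^sup>2 \<partial>Q)"
proof -
  have fa: "(\<lambda>x. f x + a) \<in> L2 P"
    by (rule L2_add[OF f M1.L2_const])
  have ga: "(\<lambda>y. g y - a) \<in> L2 Q"
    by (rule L2_diff[OF g M2.L2_const])
  define H where "H = (\<lambda>z. indicator E z * (f (fst z) + a))"
  have H: "H \<in> L2 (P \<Otimes>\<^sub>M Q)"
    unfolding H_def by (rule L2_indicator_mult[OF E_sets L2_comp_fst(1)[OF fa]])
  have sec: "(\<integral>y. (H (x, y))\<^sup>2 \<partial>Q) = measure Q (Pair x -` E) * (f x + a)\<^sup>2" for x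
  proof -
    have "(\<integral>y. (H (x, y))\<^sup>2 \<partial>Q) = (\<integral>y. indicator (Pair x -` E) y * (f x + a)\<^sup>2 \<partial>Q)"
      by (intro Bochner_Integration.integral_cong refl) (simp add: H_def indicator_def power_mult_distrib)
    also have "\<dots> = measure Q (Pair x -` E) * (f x + a)\<^sup>2"
      using sets_Pair1[OF E_sets, of x] sets.sets_into_space[of "Pair x -` E" Q]
      by (simp add: Int_absorb2)
    finally show ?thesis .
  qed
  have "\<kappa> * (\<integral>x. (f x + a)\<^sup>2 \<partial>P) = (\<integral>x. \<kappa> * (f x + a)\<^sup>2 \<partial>P)"
    by simp
  also have "\<dots> \<le> (\<integral>x. (\<integral>y. (H (x, y))\<^sup>2 \<partial>Q) \<partial>P)"
    using \<kappa> L2_squareD[OF fa]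
    by (intro integral_mono_AE integrable_fst'[OF L2_squareD[OF H]])
      (auto simp: sec elim!: eventually_mono intro: mult_right_mono)
  also have "\<dots> = (\<integral>z. (H z)\<^sup>2 \<partial>(P \<Otimes>\<^sub>M Q))"
    by (rule integral_fst'[OF L2_squareD[OF H]])
  also have "\<dots> \<le> (\<integral>z. 2 * (coupled_sum f g z)\<^sup>2 + 2 * (g (snd z) - a)\<^sup>2 \<partial>(P \<Otimes>\<^sub>M Q))"
  proof (intro integral_mono L2_squareD[OF H])
    show "integrable (P \<Otimes>\<^sub>M Q) (\<lambda>z. 2 * (coupled_sum f g z)\<^sup>2 + 2 * (g (snd z) - a)\<^sup>2)"
      using L2_squareD[OF coupled_sum_L2[OF f g]] L2_squareD[OF L2_comp_snd(1)[OF ga]] by simp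
    show "(H z)\<^sup>2 \<le> 2 * (coupled_sum f g z)\<^sup>2 + 2 * (g (snd z) - a)\<^sup>2" for z
      using square_add_le[of "f (fst z) + g (snd z)" "a - g (snd z)"]
      by (simp add: H_def coupled_sum_def indicator_def power2_commute[of a])
  qed
  also have "\<dots> = 2 * energy f g + 2 * (\<integral>y. (g y - a)\<^sup>2 \<partial>Q)"
    using L2_squareD[OF coupled_sum_L2[OF f g]] L2_squareD[OF L2_comp_snd(1)[OF ga]]
      L2_comp_snd(2)[OF ga] by (simp add: energy_def)
  finally show ?thesis .
qed

text \<open>
  Let \<open>m\<close> be the common mean. Then \<open>m + a\<close> and \<open>m - a\<close> are bounded by the two deviations, and
  their difference is \<open>2 a\<close>: this is where equality of the means is used, and it is what excludes
  the kernel elements \<open>(-a, a)\<close> of the energy.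
\<close>

lemma norm_le_of_deviations:
  assumes f: "f \<in> L2 P" and g: "g \<in> L2 Q"
    and eq: "(\<integral>x. f x \<partial>P) = (\<integral>y. g y \<partial>Q)"
  shows "(\<integral>x. (f x)\<^sup>2 \<partial>P) + (\<integral>y. (g y)\<^sup>2 \<partial>Q)
     \<le> 4 * ((\<integral>x. (f x + a)\<^sup>2 \<partial>P) + (\<integral>y. (g y - a)\<^sup>2 \<partial>Q))"
proof -
  have fa: "(\<lambda>x. f x + a) \<in> L2 P"
    by (rule L2_add[OF f M1.L2_const])
  have ga: "(\<lambda>y. g y - a) \<in> L2 Q"
    by (rule L2_diff[OF g M2.L2_const])
  let ?X = "\<integral>y. (g y - a)\<^sup>2 \<partial>Q" and ?Y = "\<integral>x. (f x + a)\<^sup>2 \<partial>P" and ?m = "\<integral>y. g y \<partial>Q"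
  have "(?m + a)\<^sup>2 \<le> ?Y"
    using M1.integral_square_le[OF fa] M1.L2_integrable[OF f] eq by (simp add: M1.prob_space)
  moreover have "(?m - a)\<^sup>2 \<le> ?X"
    using M2.integral_square_le[OF ga] M2.L2_integrable[OF g] by (simp add: M2.prob_space)
  moreover have "4 * a\<^sup>2 \<le> 2 * (?m + a)\<^sup>2 + 2 * (?m - a)\<^sup>2"
    using zero_le_power2[of ?m] by (simp add: power2_sum power2_diff)
  moreover have "(\<integral>x. (f x)\<^sup>2 \<partial>P) \<le> (\<integral>x. 2 * (f x + a)\<^sup>2 + 2 * a\<^sup>2 \<partial>P)"
    using square_add_le[of "f x + a" "- a" for x] L2_squareD[OF fa] L2_squareD[OF f]
    by (intro integral_mono) auto
  moreover have "(\<integral>y. (g y)\<^sup>2 \<partial>Q) \<le> (\<integral>y. 2 * (g y - a)\<^sup>2 + 2 * a\<^sup>2 \<partial>Q)"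
    using square_add_le[of "g y - a" a for y] L2_squareD[OF ga] L2_squareD[OF g]
    by (intro integral_mono) auto
  ultimately show ?thesis
    using L2_squareD[OF fa] L2_squareD[OF ga] by (simp add: M1.prob_space M2.prob_space)
qed

end

section \<open>Propagation of deviation bounds along the support\<close>

lemma (in prob_space) L2_deviation:
  assumes g: "g \<in> L2 M"
  shows "integrable M (\<lambda>y. (g y - a)\<^sup>2)"
    and "A \<in> sets M \<Longrightarrow> integrable M (\<lambda>y. indicator A y * (g y - a)\<^sup>2)"
proof -
  show i: "integrable M (\<lambda>y. (g y - a)\<^sup>2)"
    by (rule L2_squareD[OF L2_diff[OF g L2_const]])
  show "integrable M (\<lambda>y. indicator A y * (g y - a)\<^sup>2)" if "A \<in> sets M"
    using integrable_mult_indicator[OF that i] by simp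
qed

text \<open>
  If \<open>g\<close> is close to \<open>b\<close> on \<open>V\<close> and to \<open>a\<close> on \<open>W\<close>, then both hold on the overlap; as the overlap has
  positive mass, \<open>a\<close> and \<open>b\<close> are close, and \<open>b\<close> may be replaced by \<open>a\<close> on all of \<open>V\<close>.
\<close>

lemma (in prob_space) deviation_transfer:
  assumes g: "g \<in> L2 M"
    and V [measurable]: "V \<in> sets M" and W [measurable]: "W \<in> sets M"
    and m: "measure M (V \<inter> W) > 0"
    and dV: "(\<integral>y. indicator V y * (g y - b)\<^sup>2 \<partial>M) \<le> X"
    and dW: "(\<integral>y. indicator W y * (g y - a)\<^sup>2 \<partial>M) \<le> Y"
  shows "(\<integral>y. indicator V y * (g y - a)\<^sup>2 \<partial>M) \<le> 2 * X + 4 * (X + Y) / measure M (V \<inter> W)"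
proof -
  let ?m = "measure M (V \<inter> W)"
  note int = L2_deviation(2)[OF g]
  have "?m * (b - a)\<^sup>2 = (\<integral>y. indicator (V \<inter> W) y * (b - a)\<^sup>2 \<partial>M)"
    by (simp add: emeasure_eq_measure)
  also have "\<dots> \<le> (\<integral>y. 2 * (indicator V y * (g y - b)\<^sup>2) + 2 * (indicator W y * (g y - a)\<^sup>2) \<partial>M)"
  proof (intro integral_mono)
    show "integrable M (\<lambda>y. indicator (V \<inter> W) y * (b - a)\<^sup>2)"
      by (intro integrable_mult_left integrable_real_indicator) (auto simp: emeasure_eq_measure)
    show "integrable M (\<lambda>y. 2 * (indicator V y * (g y - b)\<^sup>2) + 2 * (indicator W y * (g y - a)\<^sup>2))"
      using int[OF V] int[OF W] by simp
    show "indicator (V \<inter> W) y * (b - a)\<^sup>2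
        \<le> 2 * (indicator V y * (g y - b)\<^sup>2) + 2 * (indicator W y * (g y - a)\<^sup>2)" for y
      using square_add_le[of "b - g y" "g y - a"]
      by (simp add: indicator_def power2_commute[of b "g y"])
  qed
  also have "\<dots> = 2 * (\<integral>y. indicator V y * (g y - b)\<^sup>2 \<partial>M)
      + 2 * (\<integral>y. indicator W y * (g y - a)\<^sup>2 \<partial>M)"
    using int[OF V] int[OF W] by simp
  finally have "?m * (b - a)\<^sup>2 \<le> 2 * X + 2 * Y"
    using dV dW by linarith
  then have ba: "(b - a)\<^sup>2 \<le> (2 * X + 2 * Y) / ?m"
    using m by (simp add: field_simps)
  have "(\<integral>y. indicator V y * (g y - a)\<^sup>2 \<partial>M)
      \<le> (\<integral>y. 2 * (indicator V y * (g y - b)\<^sup>2) + 2 * (b - a)\<^sup>2 \<partial>M)"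
  proof (intro integral_mono)
    show "indicator V y * (g y - a)\<^sup>2 \<le> 2 * (indicator V y * (g y - b)\<^sup>2) + 2 * (b - a)\<^sup>2" for y
      using square_add_le[of "g y - b" "b - a"] by (simp add: indicator_def)
  qed (use int[OF V] in simp_all)
  also have "\<dots> = 2 * (\<integral>y. indicator V y * (g y - b)\<^sup>2 \<partial>M) + 2 * (b - a)\<^sup>2"
    using int[OF V] by (simp add: prob_space)
  also have "\<dots> \<le> 2 * X + 2 * ((2 * X + 2 * Y) / ?m)"
    using dV ba by linarith
  also have "\<dots> = 2 * X + 4 * (X + Y) / ?m"
    by (simp add: field_simps)
  finally show ?thesis .
qed

lemma closed_spt: "closed (spt M)"
proof -
  have "- spt M = \<Union>{U. open U \<and> emeasure M U = 0}"
    by (auto simp: spt_def)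
  then show ?thesis
    by (metis (no_types, lifting) closed_def mem_Collect_eq open_Union)
qed

text \<open>
  The complement of the support is the union of all open null sets, and by the Lindelof property
  countably many of them suffice.
\<close>

lemma spt_full:
  fixes M :: "'a::second_countable_topology measure"
  assumes [measurable_cong]: "sets M = sets borel"
  shows "AE x in M. x \<in> spt M"
proof -
  obtain F where F: "F \<subseteq> {U. open U \<and> emeasure M U = 0}" "countable F"
      "\<Union>F = \<Union>{U. open U \<and> emeasure M U = 0}"
    by (rule Lindelof[of "{U. open U \<and> emeasure M U = 0}"]) auto
  have "(\<Union>U\<in>F. U) \<in> null_sets M"
    using F by (intro null_sets_UN') (auto simp: null_sets_def assms)
  moreover have "{x\<in>space M. x \<notin> spt M} \<subseteq> (\<Union>U\<in>F. U)"
    using F(3) by (auto simp: spt_def)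
  ultimately show ?thesis
    by (rule AE_I')
qed

lemma measure_spt_inter_pos:
  fixes M :: "'a::second_countable_topology measure"
  assumes "finite_measure M" "sets M = sets borel" "open V" "y \<in> V" "y \<in> spt M"
  shows "measure M (V \<inter> spt M) > 0"
proof -
  interpret finite_measure M by fact
  have "measure M (V \<inter> spt M) = measure M V"
    using spt_full[OF assms(2)] closed_spt[of M] \<open>open V\<close>
    by (intro finite_measure_eq_AE) (auto simp: assms(2) elim: eventually_mono)
  moreover have "emeasure M V > 0"
    using assms by (auto simp: spt_def)
  ultimately show ?thesis
    by (simp add: emeasure_eq_measure)
qed

section \<open>The Poincare-type inequality\<close>

text \<open>
  Constancy of \<open>g\<close> up to the energy spreads from one rectangle to the whole support of \<open>Q\<close>: the
  points near which \<open>g\<close> is controlled by one reference constant \<open>a f\<close> form a relatively clopen set.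
  The reference constant is read off from a single rectangle, so it depends on \<open>f\<close> but the
  constants in the estimates depend neither on \<open>f\<close> nor on \<open>g\<close>.
\<close>

theorem poincare_inequality:
  fixes P :: "'a measure" and Q :: "'b::second_countable_topology measure"
  assumes "coupled_prob_spaces P Q E"
    and sets_Q: "sets Q = sets borel"
    and compact: "compact (spt Q)" and connected: "connected (spt Q)"
    and rect: "\<And>y. y \<in> spt Q \<Longrightarrow>
        \<exists>U\<in>sets P. \<exists>V. open V \<and> y \<in> V \<and> measure P U > 0 \<and> U \<times> (V \<inter> spt Q) \<subseteq> E"
    and "\<kappa> > 0" and fibre: "AE x in P. \<kappa> \<le> measure Q (Pair x -` E)"
  obtains C where "C > 0"
    and "\<And>f g. f \<in> L2 P \<Longrightarrow> g \<in> L2 Q \<Longrightarrow> (\<integral>x. f x \<partial>P) = (\<integral>y. g y \<partial>Q) \<Longrightarrow>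
        (\<integral>x. (f x)\<^sup>2 \<partial>P) + (\<integral>y. (g y)\<^sup>2 \<partial>Q) \<le> C * coupled_prob_spaces.energy P Q E f g"
proof -
  interpret coupled_prob_spaces P Q E by fact
  have spt_sets [measurable]: "V \<inter> spt Q \<in> sets Q" if "open V" for V
    using that closed_spt[of Q] by (simp add: sets_Q)
  obtain y0 where y0: "y0 \<in> spt Q"
    using spt_full[OF sets_Q] M2.AE_False by (metis (mono_tags, lifting) AE_mp AE_I2)
  obtain U0 V0 where U0: "U0 \<in> sets P" "measure P U0 > 0" and V0: "open V0" "y0 \<in> V0"
      and UV0: "U0 \<times> (V0 \<inter> spt Q) \<subseteq> E"
    using rect[OF y0] by blast
  define a where "a f = - (\<integral>x. indicator U0 x * f x \<partial>P) / measure P U0" for f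
  \<comment> \<open>The neighbourhood and the constant are fixed before the functions: this uniformity is what
    survives the passage to a finite subcover.\<close>
  define controlled where "controlled y V C \<longleftrightarrow> open V \<and> y \<in> V \<and> 0 \<le> C \<and>
      (\<forall>f\<in>L2 P. \<forall>g\<in>L2 Q. (\<integral>z. indicator (V \<inter> spt Q) z * (g z - a f)\<^sup>2 \<partial>Q) \<le> C * energy f g)"
    for y V C
  have "\<exists>V C. controlled y V C" if "y \<in> spt Q" for y
  proof (rule connected_induction_simple[OF connected y0 that, where P = "\<lambda>y. \<exists>V C. controlled y V C"])
    have "controlled y0 V0 (1 / (measure P U0)\<^sup>2)"
      unfolding controlled_def a_def
      using V0 rectangle_estimate[OF _ _ U0(1) spt_sets U0(2) UV0] by simp
    then show "\<exists>V C. controlled y0 V C"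
      by blast
  next
    fix z assume z: "z \<in> spt Q"
    obtain U V where U: "U \<in> sets P" "measure P U > 0" and V: "open V" "z \<in> V"
      and UV: "U \<times> (V \<inter> spt Q) \<subseteq> E"
      using rect[OF z] by blast
    have "\<exists>V' C'. controlled y' V' C'"
      if "y \<in> V \<inter> spt Q" "y' \<in> V \<inter> spt Q" and "controlled y W C" for y y' W C
    proof -
      from \<open>controlled y W C\<close> have W: "open W" "y \<in> W" "0 \<le> C"
        and bound: "\<And>f g. f \<in> L2 P \<Longrightarrow> g \<in> L2 Q \<Longrightarrow>
            (\<integral>z. indicator (W \<inter> spt Q) z * (g z - a f)\<^sup>2 \<partial>Q) \<le> C * energy f g"
        by (auto simp: controlled_def)
      define m where "m = measure Q ((V \<inter> spt Q) \<inter> (W \<inter> spt Q))"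
      define B where "B = 1 / (measure P U)\<^sup>2"
      have "B \<ge> 0"
        by (simp add: B_def)
      \<comment> \<open>The overlap contains the support point \<open>y\<close>.\<close>
      have "m > 0"
        unfolding m_def
        using measure_spt_inter_pos[of Q "V \<inter> W" y] that(1) V(1) W sets_Q M2.finite_measure_axioms
        by (simp add: open_Int Int_ac)
      have "(\<integral>z. indicator (V \<inter> spt Q) z * (g z - a f)\<^sup>2 \<partial>Q)
          \<le> (2 * B + 4 * (B + C) / m) * energy f g"
        if f: "f \<in> L2 P" and g: "g \<in> L2 Q" for f g
      proof -
        have "(\<integral>z. indicator (V \<inter> spt Q) z * (g z - a f)\<^sup>2 \<partial>Q)
          \<le> 2 * (energy f g / (measure P U)\<^sup>2) + 4 * (energy f g / (measure P U)\<^sup>2 + C * energy f g) / m"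
          using M2.deviation_transfer[OF g spt_sets[OF V(1)] spt_sets[OF W(1)] _
              rectangle_estimate[OF f g U(1) spt_sets[OF V(1)] U(2) UV] bound[OF f g]] \<open>m > 0\<close>
          by (simp add: m_def)
        also have "\<dots> = (2 * B + 4 * (B + C) / m) * energy f g"
          using \<open>m > 0\<close> by (simp add: B_def field_simps)
        finally show ?thesis .
      qed
      then have "controlled y' V (2 * B + 4 * (B + C) / m)"
        using that(2) V \<open>B \<ge> 0\<close> \<open>0 \<le> C\<close> \<open>m > 0\<close> by (simp add: controlled_def)
      then show ?thesis
        by blast
    qed
    then show "\<exists>T. openin (top_of_set (spt Q)) T \<and> z \<in> T \<and>
        (\<forall>x\<in>T. \<forall>y\<in>T. (\<exists>V C. controlled x V C) \<longrightarrow> (\<exists>V C. controlled y V C))"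
      using V z by (intro exI[of _ "V \<inter> spt Q"]) (auto simp: openin_open)
  qed
  then obtain V C where VC: "\<And>y. y \<in> spt Q \<Longrightarrow> controlled y (V y) (C y)"
    by metis
  obtain D where D: "D \<subseteq> spt Q" "finite D" "spt Q \<subseteq> (\<Union>y\<in>D. V y)"
    by (rule compactE_image[OF compact, of "spt Q" V]) (use VC in \<open>auto simp: controlled_def\<close>)
  define C1 where "C1 = sum C D"
  have "C1 \<ge> 0"
    unfolding C1_def by (intro sum_nonneg) (use D(1) VC in \<open>auto simp: controlled_def\<close>)
  have dev_g: "(\<integral>y. (g y - a f)\<^sup>2 \<partial>Q) \<le> C1 * energy f g" if f: "f \<in> L2 P" and g: "g \<in> L2 Q" for f g
  proof -
    have int: "integrable Q (\<lambda>z. indicator (V y \<inter> spt Q) z * (g z - a f)\<^sup>2)" if "y \<in> D" for y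
      using that D(1) VC[of y] by (intro M2.L2_deviation(2)[OF g] spt_sets) (auto simp: controlled_def)
    have "(\<integral>z. (g z - a f)\<^sup>2 \<partial>Q) \<le> (\<integral>z. (\<Sum>y\<in>D. indicator (V y \<inter> spt Q) z * (g z - a f)\<^sup>2) \<partial>Q)"
    proof (intro integral_mono_AE M2.L2_deviation(1)[OF g] Bochner_Integration.integrable_sum int)
      show "AE z in Q. (g z - a f)\<^sup>2 \<le> (\<Sum>y\<in>D. indicator (V y \<inter> spt Q) z * (g z - a f)\<^sup>2)"
        using spt_full[OF sets_Q]
      proof eventually_elim
        case (elim z)
        then obtain y where "y \<in> D" "z \<in> V y"
          using D(3) by blast
        then show ?case
          using member_le_sum[of y D "\<lambda>y. indicator (V y \<inter> spt Q) z * (g z - a f)\<^sup>2"] D(2) elim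
          by simp
      qed
    qed
    also have "\<dots> = (\<Sum>y\<in>D. \<integral>z. indicator (V y \<inter> spt Q) z * (g z - a f)\<^sup>2 \<partial>Q)"
      by (rule Bochner_Integration.integral_sum[OF int])
    also have "\<dots> \<le> (\<Sum>y\<in>D. C y * energy f g)"
      using D(1) VC f g by (intro sum_mono) (auto simp: controlled_def)
    finally show ?thesis
      by (simp add: C1_def sum_distrib_right)
  qed
  define K where "K = 4 * ((2 + 2 * C1) / \<kappa> + C1)"
  show thesis
  proof
    show "K > 0"
      using \<open>C1 \<ge> 0\<close> \<open>\<kappa> > 0\<close> by (simp add: K_def add_pos_nonneg)
    fix f g assume f: "f \<in> L2 P" and g: "g \<in> L2 Q" and eq: "(\<integral>x. f x \<partial>P) = (\<integral>y. g y \<partial>Q)"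
    have "\<kappa> * (\<integral>x. (f x + a f)\<^sup>2 \<partial>P) \<le> 2 * energy f g + 2 * (C1 * energy f g)"
      using fibre_estimate[OF f g fibre, of "a f"] dev_g[OF f g] by linarith
    then have "(\<integral>x. (f x + a f)\<^sup>2 \<partial>P) \<le> (2 + 2 * C1) / \<kappa> * energy f g"
      using \<open>\<kappa> > 0\<close> by (simp add: field_simps)
    then show "(\<integral>x. (f x)\<^sup>2 \<partial>P) + (\<integral>y. (g y)\<^sup>2 \<partial>Q) \<le> K * energy f g"
      using norm_le_of_deviations[OF f g eq, of "a f"] dev_g[OF f g]
      unfolding K_def by (simp only: ring_distribs mult.assoc)
  qed
qed

section \<open>Projected gradient steps\<close>

lemma (in pair_prob_space) proj_oplus_mem:
  assumes f: "f \<in> L2 M1" and g: "g \<in> L2 M2"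
  shows "proj_oplus M1 M2 (f, g) \<in> L2_oplus M1 M2"
proof -
  define d where "d = ((\<integral>y. g y \<partial>M2) - (\<integral>x. f x \<partial>M1)) / 2"
  have "(\<integral>x. f x + d \<partial>M1) = (\<integral>x. f x \<partial>M1) + d" "(\<integral>y. g y - d \<partial>M2) = (\<integral>y. g y \<partial>M2) - d"
    using M1.L2_integrable[OF f] M2.L2_integrable[OF g] by (simp_all add: M1.prob_space M2.prob_space)
  moreover have "(\<integral>x. f x \<partial>M1) + d = (\<integral>y. g y \<partial>M2) - d"
    by (simp add: d_def field_simps)
  ultimately show ?thesis
    using L2_add[OF f M1.L2_const] L2_diff[OF g M2.L2_const]
    by (simp add: proj_oplus_def L2_oplus_def Let_def flip: d_def)
qed

text \<open>
  The projection removes the component along the unit normal \<open>(1, -1) / \<surd>2\<close> of the subspace, which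
  has squared length \<open>2 d\<^sup>2\<close>.
\<close>

lemma (in pair_prob_space) proj_oplus_norm_le:
  assumes f: "f \<in> L2 M1" and g: "g \<in> L2 M2"
  shows "inner_oplus M1 M2 (proj_oplus M1 M2 (f, g)) (proj_oplus M1 M2 (f, g))
    \<le> (\<integral>x. (f x)\<^sup>2 \<partial>M1) + (\<integral>y. (g y)\<^sup>2 \<partial>M2)"
proof -
  define d where "d = ((\<integral>y. g y \<partial>M2) - (\<integral>x. f x \<partial>M1)) / 2"
  have "inner_oplus M1 M2 (proj_oplus M1 M2 (f, g)) (proj_oplus M1 M2 (f, g))
      = (\<integral>x. (f x)\<^sup>2 + 2 * d * f x + d\<^sup>2 \<partial>M1) + (\<integral>y. (g y)\<^sup>2 - 2 * d * g y + d\<^sup>2 \<partial>M2)"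
    unfolding inner_oplus_def proj_oplus_def Let_def d_def[symmetric] prod.case fst_conv snd_conv
    by (intro arg_cong2[where f = "(+)"] Bochner_Integration.integral_cong refl)
      (simp_all add: power2_eq_square algebra_simps)
  also have "\<dots> = (\<integral>x. (f x)\<^sup>2 \<partial>M1) + (\<integral>y. (g y)\<^sup>2 \<partial>M2)
      + 2 * d * ((\<integral>x. f x \<partial>M1) - (\<integral>y. g y \<partial>M2)) + 2 * d\<^sup>2"
    using L2_squareD[OF f] L2_squareD[OF g] M1.L2_integrable[OF f] M2.L2_integrable[OF g]
    by (simp add: M1.prob_space M2.prob_space algebra_simps)
  also have "\<dots> = (\<integral>x. (f x)\<^sup>2 \<partial>M1) + (\<integral>y. (g y)\<^sup>2 \<partial>M2) - 2 * d\<^sup>2"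
  proof -
    have "(\<integral>x. f x \<partial>M1) - (\<integral>y. g y \<partial>M2) = - 2 * d"
      by (simp add: d_def)
    then show ?thesis
      by (simp add: power2_eq_square)
  qed
  finally show ?thesis
    by simp
qed

lemma proj_oplus_cong_AE:
  assumes "f \<in> L2 P" "f' \<in> L2 P" "g \<in> L2 Q" "g' \<in> L2 Q"
    and f: "AE x in P. f x = f' x" and g: "AE y in Q. g y = g' y"
  shows "ae_equal P Q (proj_oplus P Q (f, g)) (proj_oplus P Q (f', g'))"
proof -
  have "(\<integral>x. f x \<partial>P) = (\<integral>x. f' x \<partial>P)" "(\<integral>y. g y \<partial>Q) = (\<integral>y. g' y \<partial>Q)"
    using assms by (auto intro!: integral_cong_AE L2_measurable)
  then show ?thesis
    using f g by (simp add: ae_equal_def proj_oplus_def Let_def)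
qed

context coupled_prob_spaces
begin

lemma grad_fst_cong_AE:
  assumes [measurable]: "f \<in> borel_measurable P" "f' \<in> borel_measurable P"
      "g \<in> borel_measurable Q" "g' \<in> borel_measurable Q"
    and f: "AE x in P. f x = f' x" and g: "AE y in Q. g y = g' y"
  shows "AE x in P. grad_fst f g x = grad_fst f' g' x"
  using f AE_space
proof eventually_elim
  case (elim x)
  then have [measurable]: "x \<in> space P"
    by simp
  show ?case
    unfolding grad_fst_def
  proof (rule integral_cong_AE)
    show "AE y in Q. coupled_sum f g (x, y) = coupled_sum f' g' (x, y)"
      using g elim(1) by (auto simp: coupled_sum_def)
  qed (simp_all add: coupled_sum_def[abs_def])
qed

lemma grad_snd_cong_AE:
  assumes [measurable]: "f \<in> borel_measurable P" "f' \<in> borel_measurable P"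
      "g \<in> borel_measurable Q" "g' \<in> borel_measurable Q"
    and f: "AE x in P. f x = f' x" and g: "AE y in Q. g y = g' y"
  shows "AE y in Q. grad_snd f g y = grad_snd f' g' y"
  using g AE_space
proof eventually_elim
  case (elim y)
  then have [measurable]: "y \<in> space Q"
    by simp
  show ?case
    unfolding grad_snd_def
  proof (rule integral_cong_AE)
    show "AE x in P. coupled_sum f g (x, y) = coupled_sum f' g' (x, y)"
      using f elim(1) by (auto simp: coupled_sum_def)
  qed (simp_all add: coupled_sum_def[abs_def])
qed

definition gradient_step :: "real \<Rightarrow> ('a \<Rightarrow> real) \<Rightarrow> ('b \<Rightarrow> real) \<Rightarrow> ('a \<Rightarrow> real) \<times> ('b \<Rightarrow> real)" where
  "gradient_step c f g = (\<lambda>x. f x - c * grad_fst f g x, \<lambda>y. g y - c * grad_snd f g y)"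

lemma gradient_step_L2:
  assumes "f \<in> L2 P" "g \<in> L2 Q"
  shows "fst (gradient_step c f g) \<in> L2 P" "snd (gradient_step c f g) \<in> L2 Q"
  unfolding gradient_step_def fst_conv snd_conv
  by (intro L2_diff L2_cmult grad_L2 assms)+

lemma gradient_step_cong_AE:
  assumes "f \<in> L2 P" "f' \<in> L2 P" "g \<in> L2 Q" "g' \<in> L2 Q"
    and AE: "AE x in P. f x = f' x" "AE y in Q. g y = g' y"
  shows "ae_equal P Q (gradient_step c f g) (gradient_step c f' g')"
proof -
  note meas = assms(1-4)[THEN L2_measurable]
  have "AE x in P. fst (gradient_step c f g) x = fst (gradient_step c f' g') x"
    using grad_fst_cong_AE[OF meas AE] AE(1) by eventually_elim (simp add: gradient_step_def)
  moreover have "AE y in Q. snd (gradient_step c f g) y = snd (gradient_step c f' g') y"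
    using grad_snd_cong_AE[OF meas AE] AE(2) by eventually_elim (simp add: gradient_step_def)
  ultimately show ?thesis
    by (simp add: ae_equal_def)
qed

end

lemma ae_equal_sym: "ae_equal P Q h k \<Longrightarrow> ae_equal P Q k h"
  by (auto simp: ae_equal_def elim: eventually_mono)

lemma ae_equal_trans: "ae_equal P Q h k \<Longrightarrow> ae_equal P Q k l \<Longrightarrow> ae_equal P Q h l"
  unfolding ae_equal_def by (auto elim: eventually_elim2)

text \<open>
  The pair that is projected has to agree with the gradient step only almost everywhere, because in
  the linearized operator it is set to zero outside the supports.
\<close>

theorem projected_step_is_contraction:
  fixes P :: "'a measure" and Q :: "'b measure"
  assumes "coupled_prob_spaces P Q E" and c: "0 < c" "c < 1" and "C > 0"
    and poincare: "\<And>f g. f \<in> L2 P \<Longrightarrow> g \<in> L2 Q \<Longrightarrow> (\<integral>x. f x \<partial>P) = (\<integral>y. g y \<partial>Q) \<Longrightarrow>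
        (\<integral>x. (f x)\<^sup>2 \<partial>P) + (\<integral>y. (g y)\<^sup>2 \<partial>Q) \<le> C * coupled_prob_spaces.energy P Q E f g"
    and T: "\<And>f g. (f, g) \<in> L2_oplus P Q \<Longrightarrow> \<exists>u\<in>borel_measurable P. \<exists>v\<in>borel_measurable Q.
        T (f, g) = proj_oplus P Q (u, v) \<and>
        ae_equal P Q (coupled_prob_spaces.gradient_step P Q E c f g) (u, v)"
  shows "operator_on_oplus P Q T \<and> op_norm_oplus P Q T < 1"
proof
  interpret coupled_prob_spaces P Q E by fact
  have T_step: "\<exists>u\<in>L2 P. \<exists>v\<in>L2 Q. T (f, g) = proj_oplus P Q (u, v) \<and>
      ae_equal P Q (gradient_step c f g) (u, v)"
    if fg: "(f, g) \<in> L2_oplus P Q" for f g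
  proof -
    from T[OF fg] obtain u v where uv: "u \<in> borel_measurable P" "v \<in> borel_measurable Q"
      "T (f, g) = proj_oplus P Q (u, v)" "ae_equal P Q (gradient_step c f g) (u, v)"
      by blast
    have "f \<in> L2 P" "g \<in> L2 Q"
      using fg by (auto simp: L2_oplus_def)
    note step = gradient_step_L2[OF this, of c]
    have "u \<in> L2 P" "v \<in> L2 Q"
      using L2_cong_AE[OF step(1) uv(1)] L2_cong_AE[OF step(2) uv(2)] uv(4)
      by (simp_all add: ae_equal_def)
    with uv show ?thesis
      by blast
  qed
  show "operator_on_oplus P Q T"
    unfolding operator_on_oplus_def
  proof (intro conjI ballI impI)
    fix h assume "h \<in> L2_oplus P Q"
    then obtain u v where "u \<in> L2 P" "v \<in> L2 Q" "T h = proj_oplus P Q (u, v)"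
      using T_step[of "fst h" "snd h"] by auto
    then show "T h \<in> L2_oplus P Q"
      by (simp add: proj_oplus_mem)
  next
    fix h k assume h: "h \<in> L2_oplus P Q" and k: "k \<in> L2_oplus P Q" and hk: "ae_equal P Q h k"
    obtain f g where hfg: "h = (f, g)" by force
    obtain f' g' where kfg: "k = (f', g')" by force
    have step: "ae_equal P Q (gradient_step c f g) (gradient_step c f' g')"
      using h k hk by (intro gradient_step_cong_AE) (auto simp: hfg kfg ae_equal_def L2_oplus_def)
    obtain u v where uv: "u \<in> L2 P" "v \<in> L2 Q" "T h = proj_oplus P Q (u, v)"
      "ae_equal P Q (gradient_step c f g) (u, v)"
      using T_step[of f g] h hfg by blast
    obtain u' v' where uv': "u' \<in> L2 P" "v' \<in> L2 Q" "T k = proj_oplus P Q (u', v')"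
      "ae_equal P Q (gradient_step c f' g') (u', v')"
      using T_step[of f' g'] k kfg by blast
    have "ae_equal P Q (u, v) (u', v')"
      using ae_equal_trans[OF ae_equal_sym[OF uv(4)] ae_equal_trans[OF step uv'(4)]] .
    then show "ae_equal P Q (T h) (T k)"
      unfolding uv(3) uv'(3) by (intro proj_oplus_cong_AE uv uv') (simp_all add: ae_equal_def)
  qed
  define \<delta> where "\<delta> = 2 * c * (1 - c) / C"
  have "\<delta> > 0"
    using c \<open>C > 0\<close> by (simp add: \<delta>_def)
  \<comment> \<open>The maximum covers the case of a constant \<open>C\<close> so small that \<open>1 - \<delta>\<close> is negative.\<close>
  have "norm_oplus P Q (T h) \<le> sqrt (max 0 (1 - \<delta>))"
    if h: "h \<in> L2_oplus P Q" and le1: "norm_oplus P Q h \<le> 1" for h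
  proof -
    obtain f g where hfg: "h = (f, g)" by force
    have f: "f \<in> L2 P" and g: "g \<in> L2 Q" and eq: "(\<integral>x. f x \<partial>P) = (\<integral>y. g y \<partial>Q)"
      using h by (auto simp: hfg L2_oplus_def)
    obtain u v where u: "u \<in> L2 P" and v: "v \<in> L2 Q" and Th: "T h = proj_oplus P Q (u, v)"
      and step: "ae_equal P Q (gradient_step c f g) (u, v)"
      using T_step[of f g] h hfg by blast
    let ?N = "(\<integral>x. (f x)\<^sup>2 \<partial>P) + (\<integral>y. (g y)\<^sup>2 \<partial>Q)"
    have N: "0 \<le> ?N" "?N \<le> 1"
      using le1 by (simp_all add: norm_oplus_def inner_oplus_def hfg power2_eq_square)
    have "inner_oplus P Q (T h) (T h) \<le> (\<integral>x. (u x)\<^sup>2 \<partial>P) + (\<integral>y. (v y)\<^sup>2 \<partial>Q)"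
      unfolding Th by (rule proj_oplus_norm_le[OF u v])
    also have "(\<integral>x. (u x)\<^sup>2 \<partial>P) = (\<integral>x. (fst (gradient_step c f g) x)\<^sup>2 \<partial>P)"
      using step L2_squareD[OF u] L2_squareD[OF gradient_step_L2(1)[OF f g, of c]]
      by (intro integral_cong_AE) (auto simp: ae_equal_def elim: eventually_mono)
    also have "(\<integral>y. (v y)\<^sup>2 \<partial>Q) = (\<integral>y. (snd (gradient_step c f g) y)\<^sup>2 \<partial>Q)"
      using step L2_squareD[OF v] L2_squareD[OF gradient_step_L2(2)[OF f g, of c]]
      by (intro integral_cong_AE) (auto simp: ae_equal_def elim: eventually_mono)
    also have "(\<integral>x. (fst (gradient_step c f g) x)\<^sup>2 \<partial>P) + (\<integral>y. (snd (gradient_step c f g) y)\<^sup>2 \<partial>Q)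
        \<le> ?N - 2 * c * (1 - c) * energy f g"
      unfolding gradient_step_def fst_conv snd_conv by (rule gradient_step_norm_le[OF f g])
    also have "\<dots> \<le> ?N - \<delta> * ?N"
    proof -
      have "\<delta> * ?N \<le> \<delta> * (C * energy f g)"
        using poincare[OF f g eq] \<open>\<delta> > 0\<close> by (intro mult_left_mono) auto
      then show ?thesis
        using \<open>C > 0\<close> by (simp add: \<delta>_def)
    qed
    also have "\<dots> = (1 - \<delta>) * ?N"
      by (simp add: algebra_simps)
    also have "\<dots> \<le> max 0 (1 - \<delta>) * 1"
      using N by (intro mult_mono) auto
    finally show ?thesis
      unfolding norm_oplus_def by simp
  qed
  then have "op_norm_oplus P Q T \<le> ereal (sqrt (max 0 (1 - \<delta>)))"
    unfolding op_norm_oplus_def by (intro SUP_least) auto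
  also have "\<dots> < 1"
    using \<open>\<delta> > 0\<close> by simp
  finally show "op_norm_oplus P Q T < 1" .
qed

section \<open>The contact set of the potentials\<close>

text \<open>
  The slack is continuous only on the product of the supports, where the potentials are; hence
  the restriction to support points in the contact set, which makes it closed.
\<close>

definition slack :: "('a::real_normed_vector \<Rightarrow> real) \<Rightarrow> ('a \<Rightarrow> real) \<Rightarrow> 'a \<times> 'a \<Rightarrow> real" where
  "slack f g z = f (fst z) + g (snd z) - (norm (fst z - snd z))\<^sup>2 / 2"

definition contact_set :: "'a::real_normed_vector measure \<Rightarrow> 'a measure \<Rightarrow>
    ('a \<Rightarrow> real) \<Rightarrow> ('a \<Rightarrow> real) \<Rightarrow> ('a \<times> 'a) set" where
  "contact_set P Q f g = {z \<in> spt P \<times> spt Q. 0 \<le> slack f g z}"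

lemma continuous_on_slack:
  assumes "continuous_on A f" "continuous_on B g"
  shows "continuous_on (A \<times> B) (slack f g)"
proof -
  have "continuous_on (A \<times> B) (\<lambda>z. f (fst z))"
    by (rule continuous_on_compose2[OF assms(1)]) (auto intro: continuous_intros)
  moreover have "continuous_on (A \<times> B) (\<lambda>z. g (snd z))"
    by (rule continuous_on_compose2[OF assms(2)]) (auto intro: continuous_intros)
  ultimately show ?thesis
    unfolding slack_def[abs_def] by (auto intro!: continuous_intros)
qed

lemma closed_contact_set:
  assumes "continuous_on (spt P) f" "continuous_on (spt Q) g"
  shows "closed (contact_set P Q f g)"
proof -
  have "contact_set P Q f g = (spt P \<times> spt Q) \<inter> slack f g -` {0..}"
    by (auto simp: contact_set_def)
  then show ?thesis
    using continuous_closed_preimage[OF continuous_on_slack[OF assms], of "{0..}"]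
    by (simp add: closed_spt closed_Times)
qed

lemma slack_pos_rectangle:
  assumes "continuous_on A f" "continuous_on B g"
    and "x \<in> A" "y \<in> B" and "slack f g (x, y) > 0"
  obtains U V where "open U" "x \<in> U" "open V" "y \<in> V"
    and "\<And>z. z \<in> (U \<inter> A) \<times> (V \<inter> B) \<Longrightarrow> slack f g z > 0"
proof -
  have "openin (top_of_set (A \<times> B)) ((A \<times> B) \<inter> slack f g -` {0<..})"
    by (rule continuous_openin_preimage_gen[OF continuous_on_slack[OF assms(1,2)]]) simp
  then obtain W where "open W" and W: "(A \<times> B) \<inter> slack f g -` {0<..} = (A \<times> B) \<inter> W"
    unfolding openin_open by blast
  have "(x, y) \<in> W"
    using assms(3-5) W by auto
  then obtain U V where "open U" "open V" "(x, y) \<in> U \<times> V" "U \<times> V \<subseteq> W"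
    using open_prod_elim[OF \<open>open W\<close>] by metis
  moreover have "slack f g z > 0" if "z \<in> (U \<inter> A) \<times> (V \<inter> B)" for z
  proof -
    have "z \<in> (A \<times> B) \<inter> W"
      using that \<open>U \<times> V \<subseteq> W\<close> by auto
    then show ?thesis
      using W by auto
  qed
  ultimately show thesis
    using that by auto
qed

lemma pos_of_set_integral_pos:
  fixes h :: "'a \<Rightarrow> real"
  assumes "0 < (LINT x:A|M. max (h x) 0)"
  obtains x where "x \<in> A" "h x > 0"
proof (rule ccontr)
  assume "\<not> thesis"
  then have "(\<lambda>x. indicator A x *\<^sub>R max (h x) 0) = (\<lambda>x. 0)"
    using that by (force simp: indicator_def max_def)
  then show False
    using assms by (simp add: set_lebesgue_integral_def)
qed

text \<open>
  Positivity of the integral certifies that the integrand is integrable, as the Bochner integral of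
  a non-integrable function is zero.
\<close>

lemma (in finite_measure) measure_positive_set_ge:
  fixes h :: "'a \<Rightarrow> real"
  assumes "0 < (LINT x:A|M. max (h x) 0)" and "\<And>x. x \<in> A \<Longrightarrow> h x \<le> B"
    and "0 \<le> B" and "{x \<in> A. 0 \<le> h x} \<in> sets M"
  shows "(LINT x:A|M. max (h x) 0) \<le> B * measure M {x \<in> A. 0 \<le> h x}"
proof -
  let ?S = "{x \<in> A. 0 \<le> h x}"
  have "integrable M (\<lambda>x. indicator A x *\<^sub>R max (h x) 0)"
    using assms(1) not_integrable_integral_eq unfolding set_lebesgue_integral_def by fastforce
  then have "(LINT x:A|M. max (h x) 0) \<le> (\<integral>x. B * indicator ?S x \<partial>M)"
    unfolding set_lebesgue_integral_def
  proof (rule integral_mono)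
    show "integrable M (\<lambda>x. B * indicator ?S x)"
      using assms(4) by (intro integrable_mult_right integrable_real_indicator)
        (simp_all add: emeasure_eq_measure)
    show "indicator A x *\<^sub>R max (h x) 0 \<le> B * indicator ?S x" for x
      using assms(2)[of x] assms(3) by (auto simp: indicator_def max_def)
  qed
  also have "\<dots> = B * measure M ?S"
    using sets.sets_into_space[OF assms(4)] by (simp add: Int_absorb2)
  finally show ?thesis .
qed

theorem proposition4p1:
  fixes P Q :: "(real ^ 'd) measure"
    and \<epsilon> \<eta> :: real
    and fs gs :: "real ^ 'd \<Rightarrow> real"
  assumes "\<epsilon> > 0"
    and "prob_space P" and "sets P = sets borel"
    and "prob_space Q" and "sets Q = sets borel"
    and "no_convex_boundary_mass P" and "no_convex_boundary_mass Q"
    and "compact (spt P)" and "compact (spt Q)"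
    and "connected (spt Q)"
    and "potentials \<epsilon> P Q fs gs"
    and "0 < \<eta>" and "\<eta> < \<epsilon>"
  shows "operator_on_oplus P Q (lin_gd \<eta> \<epsilon> P Q fs gs)
    \<and> op_norm_oplus P Q (lin_gd \<eta> \<epsilon> P Q fs gs) < 1"
proof -
  note sets_P = \<open>sets P = sets borel\<close> and sets_Q = \<open>sets Q = sets borel\<close>
  interpret P: prob_space P by fact
  interpret Q: prob_space Q by fact
  define E where "E = contact_set P Q fs gs"
  have cont: "continuous_on (spt P) fs" "continuous_on (spt Q) gs"
    and eq_y: "\<And>y. y \<in> spt Q \<Longrightarrow> \<epsilon> = (LINT x:spt P|P. max (slack fs gs (x, y)) 0)"
    and eq_x: "\<And>x. x \<in> spt P \<Longrightarrow> \<epsilon> = (LINT y:spt Q|Q. max (slack fs gs (x, y)) 0)"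
    using \<open>potentials \<epsilon> P Q fs gs\<close> by (auto simp: potentials_def slack_def)
  have "E \<in> sets (P \<Otimes>\<^sub>M Q)"
    unfolding sets_pair_measure_cong[OF sets_P sets_Q] borel_prod E_def
    using closed_contact_set[OF cont] by (rule borel_closed)
  then interpret E: coupled_prob_spaces P Q E
    by unfold_locales
  have section_S: "section_S Q fs gs x = Pair x -` E" if "x \<in> spt P" for x
    using that by (auto simp: section_S_def E_def contact_set_def slack_def)
  have section_T: "section_T P fs gs y = (\<lambda>x. (x, y)) -` E" if "y \<in> spt Q" for y
    using that by (auto simp: section_T_def E_def contact_set_def slack_def)
  have section_sets [measurable]: "Pair x -` E \<in> sets Q" "(\<lambda>x. (x, y)) -` E \<in> sets P" for x y
    using sets_Pair1[OF E.E_sets] sets_Pair2[OF E.E_sets] by auto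

  \<comment> \<open>As \<open>\<epsilon> > 0\<close>, the equation at \<open>y\<close> forces positive slack at some \<open>(x, y)\<close>,
    and continuity spreads it.\<close>
  have rect: "\<exists>U\<in>sets P. \<exists>V. open V \<and> y \<in> V \<and> measure P U > 0 \<and> U \<times> (V \<inter> spt Q) \<subseteq> E"
    if y: "y \<in> spt Q" for y
  proof -
    obtain x where x: "x \<in> spt P" "slack fs gs (x, y) > 0"
      using pos_of_set_integral_pos eq_y[OF y] \<open>\<epsilon> > 0\<close> by metis
    then obtain U V where UV: "open U" "x \<in> U" "open V" "y \<in> V"
      and "\<And>z. z \<in> (U \<inter> spt P) \<times> (V \<inter> spt Q) \<Longrightarrow> slack fs gs z > 0"
      using slack_pos_rectangle[OF cont _ y] by metis
    then have "(U \<inter> spt P) \<times> (V \<inter> spt Q) \<subseteq> E"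
      by (force simp: E_def contact_set_def)
    moreover have "measure P (U \<inter> spt P) > 0"
      using measure_spt_inter_pos[OF P.finite_measure_axioms sets_P UV(1,2) x(1)] .
    moreover have "U \<inter> spt P \<in> sets P"
      using UV(1) closed_spt[of P] by (simp add: sets_P)
    ultimately show ?thesis
      using UV by blast
  qed

  obtain B where B: "B > 0" "\<And>z. z \<in> spt P \<times> spt Q \<Longrightarrow> slack fs gs z \<le> B"
  proof -
    have "bounded (slack fs gs ` (spt P \<times> spt Q))"
      using \<open>compact (spt P)\<close> \<open>compact (spt Q)\<close>
      by (intro compact_imp_bounded compact_continuous_image continuous_on_slack cont compact_Times)
    then obtain B where "B > 0" "\<And>z. z \<in> spt P \<times> spt Q \<Longrightarrow> norm (slack fs gs z) \<le> B"
      unfolding bounded_pos by auto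
    then show ?thesis
      using that[of B] by (metis abs_ge_self order_trans real_norm_def)
  qed
  \<comment> \<open>The slack is at most \<open>B\<close> and its positive part lives on the section, whose mass is thus at least
    \<open>\<epsilon> / B\<close>.\<close>
  have fibre: "AE x in P. \<epsilon> / B \<le> measure Q (Pair x -` E)"
    using spt_full[OF sets_P]
  proof eventually_elim
    case (elim x)
    have *: "{y \<in> spt Q. 0 \<le> slack fs gs (x, y)} = Pair x -` E"
      using elim by (auto simp: E_def contact_set_def)
    have "\<epsilon> \<le> B * measure Q (Pair x -` E)"
      using Q.measure_positive_set_ge[of "spt Q" "\<lambda>y. slack fs gs (x, y)" B] eq_x[OF elim]
        \<open>\<epsilon> > 0\<close> B elim section_sets(1) unfolding * by simp
    then show ?case
      using \<open>B > 0\<close> by (simp add: field_simps)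
  qed
  obtain C where C: "C > 0" "\<And>f g. f \<in> L2 P \<Longrightarrow> g \<in> L2 Q \<Longrightarrow> (\<integral>x. f x \<partial>P) = (\<integral>y. g y \<partial>Q) \<Longrightarrow>
      (\<integral>x. (f x)\<^sup>2 \<partial>P) + (\<integral>y. (g y)\<^sup>2 \<partial>Q) \<le> C * E.energy f g"
    by (rule poincare_inequality[OF E.coupled_prob_spaces_axioms sets_Q \<open>compact (spt Q)\<close>
          \<open>connected (spt Q)\<close> rect _ fibre])
      (use \<open>\<epsilon> > 0\<close> \<open>B > 0\<close> in auto)

  let ?c = "\<eta> / \<epsilon>"
  show ?thesis
  proof (rule projected_step_is_contraction[OF E.coupled_prob_spaces_axioms _ _ C, where c = ?c])
    fix f g assume fg: "(f, g) \<in> L2_oplus P Q"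
    then have f: "f \<in> L2 P" and g: "g \<in> L2 Q"
      by (auto simp: L2_oplus_def)
    let ?u = "\<lambda>x. if x \<in> spt P then fst (E.gradient_step ?c f g) x else 0"
    let ?v = "\<lambda>y. if y \<in> spt Q then snd (E.gradient_step ?c f g) y else 0"
    have "E.grad_fst f g x = f x * measure Q (section_S Q fs gs x) + (LINT y:section_S Q fs gs x|Q. g y)"
      if "x \<in> spt P" for x
    proof -
      have "E.grad_fst f g x
          = (\<integral>y. f x * indicator (Pair x -` E) y + indicator (Pair x -` E) y * g y \<partial>Q)"
        unfolding E.grad_fst_def
        by (intro Bochner_Integration.integral_cong refl) (simp add: E.coupled_sum_def indicator_def)
      also have "\<dots> = f x * measure Q (Pair x -` E) + (\<integral>y. indicator (Pair x -` E) y * g y \<partial>Q)"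
        using Q.L2_integrable[OF L2_indicator_mult[OF section_sets(1) g], of x]
          sets.sets_into_space[OF section_sets(1), of x]
        by (simp add: Q.emeasure_eq_measure Int_absorb2)
      finally show ?thesis
        by (simp add: section_S[OF that] set_lebesgue_integral_def)
    qed
    moreover have "E.grad_snd f g y = g y * measure P (section_T P fs gs y) + (LINT x:section_T P fs gs y|P. f x)"
      if "y \<in> spt Q" for y
    proof -
      let ?T = "(\<lambda>x. (x, y)) -` E"
      have "E.grad_snd f g y = (\<integral>x. g y * indicator ?T x + indicator ?T x * f x \<partial>P)"
        unfolding E.grad_snd_def
        by (intro Bochner_Integration.integral_cong refl) (simp add: E.coupled_sum_def indicator_def)
      also have "\<dots> = g y * measure P ?T + (\<integral>x. indicator ?T x * f x \<partial>P)"
        using P.L2_integrable[OF L2_indicator_mult[OF section_sets(2) f], of y]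
          sets.sets_into_space[OF section_sets(2), of y]
        by (simp add: P.emeasure_eq_measure Int_absorb2)
      finally show ?thesis
        by (simp add: section_T[OF that] set_lebesgue_integral_def)
    qed
    ultimately have "lin_gd \<eta> \<epsilon> P Q fs gs (f, g) = proj_oplus P Q (?u, ?v)"
      unfolding lin_gd_def prod.case
      by (intro arg_cong[where f = "proj_oplus P Q"] prod_eqI ext)
        (simp_all add: E.gradient_step_def algebra_simps add_divide_distrib)
    moreover have "?u \<in> borel_measurable P" "?v \<in> borel_measurable Q"
      using E.gradient_step_L2[OF f g, of ?c, THEN L2_measurable] closed_spt[of P] closed_spt[of Q]
      by (auto intro!: measurable_If_set simp: sets_P sets_Q)
    moreover have "ae_equal P Q (E.gradient_step ?c f g) (?u, ?v)"
      using spt_full[OF sets_P] spt_full[OF sets_Q]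
      by (auto simp: ae_equal_def elim: eventually_mono)
    ultimately show "\<exists>u\<in>borel_measurable P. \<exists>v\<in>borel_measurable Q.
        lin_gd \<eta> \<epsilon> P Q fs gs (f, g) = proj_oplus P Q (u, v) \<and>
        ae_equal P Q (E.gradient_step ?c f g) (u, v)"
      by blast
  qed (use \<open>\<epsilon> > 0\<close> \<open>0 < \<eta>\<close> \<open>\<eta> < \<epsilon>\<close> in auto)
qed

end
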